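(* Let $G$ be a two-layer network with layers $G_1=(V_1,E_1)$ ($n$ nodes) and $G_2=(V_2,E_2)$ ($m$ nodes), $V=V_1\cup V_2$, and set of interlayer links $E_3$. Assume that the regularity condition $$W\boldsymbol 1_m\in\mathrm{span}\{\boldsymbol 1_n\},\qquad W^T\boldsymbol 1_n\in\mathrm{span}\{\boldsymbol 1_m\}$$ (the interlayer weight matrix $W$ has constant row sums and constant column sums) is feasible. For budget values up to the threshold $c^*$, $c\le c^*$, the optimal solution of the graph embedding problem $$\begin{aligned}\underset{\xi\in\mathbb R,\ u_i\in\mathbb R^{n+m}\,(i\in V)}{\text{maximize}}\quad & c\,\xi-\sum_{\{i,j\}\in E_1\cup E_2}\|u_i-u_j\|^2\\ \text{subject to}\quad & \sum_{i\in V}\|u_i\|^2=1,\quad \sum_{i\in V}u_i=0,\\ & \|u_i-u_j\|^2\le-\xi\quad\forall\,\{i,j\}\in E_3\end{aligned}$$ is given as $$u_i^*=\begin{cases} m\,h, & i\in V_1,\\ -n\,h, & i\in V_2,\end{cases}$$ where $\langle h\rangle$ (the span of the vector $h$) is a one-dimensional subspace.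
   Context: $G_1=(V_1,E_1)$ and $G_2=(V_2,E_2)$ are finite undirected connected graphs with unit link weights on disjoint vertex sets, $|V_1|=n$, $|V_2|=m$, with Laplacian matrices $L_1,L_2$; $E_3\subseteq\{\{i,j\}:i\in V_1,j\in V_2\}$ is the set of interlayer links. The interlayer weights form a nonnegative $n\times m$ matrix $W=[w_{ij}]$ supported on $E_3$, subject to a total budget $\boldsymbol 1_n^TW\boldsymbol 1_m=c\ge 0$, where $\boldsymbol 1_k$ is the all-ones vector in $\mathbb R^k$. The Laplacian of the whole network is $$L(W)=\begin{bmatrix} L_1+\mathrm{diag}(W\boldsymbol 1_m) & -W\\ -W^T & L_2+\mathrm{diag}(W^T\boldsymbol 1_n)\end{bmatrix},$$ with ordered eigenvalues $0=\lambda_1\le\lambda_2\le\lambda_3\le\cdots$. The underlying optimization problem is to maximize the algebraic connectivity, $F(c)=\max\{\lambda_2[L(W)]\}$ over all such $W$ with total budget $c$; the graph embedding problem is (the Gram-vector form of) its dual semidefinite program. Threshold $c^*$ of this maximization problem: when regularity is feasible, $(\frac1n+\frac1m)c$ is, for regular $W$, always an eigenvalue of $L(W)$ with eigenvector $\begin{bmatrix} m\boldsymbol 1_n\\ -n\boldsymbol 1_m\end{bmatrix}$, and it is an upper bound for $F(c)$. For sufficiently small $c$, starting from zero and increasing, it is the maximum algebraic connectivity, attained by regular weights. As $c$ increases, this eigenvalue grows linearly, and $c^*$ is the transition threshold budget at which the second and third smallest eigenvalues coalesce; for $c\le c^*$ one has $F(c)=(\frac1n+\frac1m)c$, attained only under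 the regularity condition, while after $c^*$ the optimal weights are generally nonregular and $F$ is a nonlinear function of $c$.
   Formalization: Optimality of u* is proved for all c ≤ c*, but that every optimal solution has this form only for c < c*: at c = c* it can fail (two single-edge layers, all four interlayer links, c = c* = 4, u = (1,-1,0,0)/√2 times a unit vector). *)

theory Defs
  imports "HOL-Analysis.Analysis"
begin

text \<open>
  The vertex sets of the two layers are finite types \<open>'a\<close> and \<open>'b\<close>, so that \<open>n = CARD('a)\<close>,
  \<open>m = CARD('b)\<close>; the vertex set of the whole network is the sum type \<open>'a + 'b\<close>, which makes the
  two layers disjoint. An interlayer link \<open>{i, j}\<close> with \<open>i\<close> in the first and \<open>j\<close> in the second
  layer is the pair \<open>(i, j)\<close>. The vector \<open>1 :: real ^ 'n\<close> is the all-ones vector.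
\<close>

definition simple_graph :: "'v set set \<Rightarrow> bool" where
  "simple_graph E \<longleftrightarrow> (\<forall>e\<in>E. card e = 2)"

definition connected_graph :: "'v set set \<Rightarrow> bool" where
  "connected_graph E \<longleftrightarrow> (\<forall>i j. (i, j) \<in> {(x, y). {x, y} \<in> E}\<^sup>*)"

definition laplacian :: "'v::finite set set \<Rightarrow> real ^ 'v ^ 'v" where
  "laplacian E = (\<chi> i j. if i = j then real (card {k. {i, k} \<in> E})
                          else if {i, j} \<in> E then -1 else 0)"

definition network_laplacian ::
  "'a::finite set set \<Rightarrow> 'b::finite set set \<Rightarrow> real ^ 'b ^ 'a \<Rightarrow> real ^ ('a + 'b) ^ ('a + 'b)" where
  "network_laplacian E1 E2 W = (\<chi> p q. case (p, q) of
       (Inl i, Inl j) \<Rightarrow> laplacian E1 $ i $ j + (if i = j then (W *v 1) $ i else 0)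
     | (Inl i, Inr j) \<Rightarrow> - (W $ i $ j)
     | (Inr j, Inl i) \<Rightarrow> - (W $ i $ j)
     | (Inr i, Inr j) \<Rightarrow> laplacian E2 $ i $ j + (if i = j then (transpose W *v 1) $ i else 0))"

definition weights :: "('a::finite \<times> 'b::finite) set \<Rightarrow> real \<Rightarrow> (real ^ 'b ^ 'a) set" where
  "weights E3 c = {W. (\<forall>i j. 0 \<le> W $ i $ j) \<and> (\<forall>i j. (i, j) \<notin> E3 \<longrightarrow> W $ i $ j = 0) \<and>
                      (1 :: real ^ 'a) \<bullet> (W *v 1) = c}"

definition regular_weights :: "real ^ 'b::finite ^ 'a::finite \<Rightarrow> bool" where
  "regular_weights W \<longleftrightarrow> W *v 1 \<in> span {1} \<and> transpose W *v 1 \<in> span {1}"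

text \<open>
  The budget is required to be positive because the zero matrix is always regular. Since
  regularity is invariant under scaling, feasibility for one positive budget is feasibility for
  every budget.
\<close>
definition regularity_feasible :: "('a::finite \<times> 'b::finite) set \<Rightarrow> bool" where
  "regularity_feasible E3 \<longleftrightarrow> (\<exists>b>0. \<exists>W\<in>weights E3 b. regular_weights W)"

text \<open>
  Eigenvalues in increasing order, repeated by the dimension of the eigenspace. This is only
  applied to symmetric matrices, for which geometric and algebraic multiplicity agree, so that
  the list has as many entries as the matrix has rows.
\<close>
definition eigenspace :: "real ^ 'v ^ 'v \<Rightarrow> real \<Rightarrow> (real ^ 'v::finite) set" where
  "eigenspace A x = {v. A *v v = x *\<^sub>R v}"

definition ordered_eigenvalues :: "real ^ 'v ^ 'v::finite \<Rightarrow> real list" where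
  "ordered_eigenvalues A =
     concat (map (\<lambda>x. replicate (dim (eigenspace A x)) x)
       (sorted_list_of_set {x. \<exists>v\<in>eigenspace A x. v \<noteq> 0}))"

text \<open>Numbered from 1, as in \<open>\<lambda>\<^sub>1 \<le> \<lambda>\<^sub>2 \<le> \<dots>\<close>.\<close>
definition eigval :: "nat \<Rightarrow> real ^ 'v ^ 'v::finite \<Rightarrow> real" where
  "eigval k A = ordered_eigenvalues A ! (k - 1)"

definition max_connectivity_weights ::
  "'a::finite set set \<Rightarrow> 'b::finite set set \<Rightarrow> ('a \<times> 'b) set \<Rightarrow> real \<Rightarrow> (real ^ 'b ^ 'a) set" where
  "max_connectivity_weights E1 E2 E3 c = {W \<in> weights E3 c. \<forall>W'\<in>weights E3 c.
     eigval 2 (network_laplacian E1 E2 W') \<le> eigval 2 (network_laplacian E1 E2 W)}"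

text \<open>
  Optimal weights need not be unique, and below the threshold some of them may already have
  \<open>\<lambda>\<^sub>2 = \<lambda>\<^sub>3\<close> while others keep the two eigenvalues apart. The threshold is the budget at which
  the coalescence becomes unavoidable. If both layers are single vertices there is no third
  eigenvalue, hence no coalescence, and the threshold is infinite.
\<close>
definition eigenvalues_coalesce ::
  "'a::finite set set \<Rightarrow> 'b::finite set set \<Rightarrow> ('a \<times> 'b) set \<Rightarrow> real \<Rightarrow> bool" where
  "eigenvalues_coalesce E1 E2 E3 c \<longleftrightarrow> 3 \<le> CARD('a) + CARD('b) \<and>
     (\<forall>W\<in>max_connectivity_weights E1 E2 E3 c.
        eigval 2 (network_laplacian E1 E2 W) = eigval 3 (network_laplacian E1 E2 W))"

definition threshold_budget ::
  "'a::finite set set \<Rightarrow> 'b::finite set set \<Rightarrow> ('a \<times> 'b) set \<Rightarrow> ereal" where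
  "threshold_budget E1 E2 E3 = (INF c\<in>{c. 0 \<le> c \<and> eigenvalues_coalesce E1 E2 E3 c}. ereal c)"

definition layer_links :: "'a set set \<Rightarrow> 'b set set \<Rightarrow> ('a + 'b) set set" where
  "layer_links E1 E2 = (image Inl) ` E1 \<union> (image Inr) ` E2"

text \<open>The sum over ordered pairs counts every link twice, hence the division by 2.\<close>
definition link_sum :: "'v set set \<Rightarrow> ('v \<Rightarrow> 'v \<Rightarrow> real) \<Rightarrow> real" where
  "link_sum E f = (\<Sum>(i, j)\<in>{(i, j). {i, j} \<in> E}. f i j) / 2"

definition embedding_objective ::
  "'a::finite set set \<Rightarrow> 'b::finite set set \<Rightarrow> real \<Rightarrow> real \<Rightarrow> ('a + 'b \<Rightarrow> real ^ ('a + 'b)) \<Rightarrow> real" where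
  "embedding_objective E1 E2 c \<xi> u =
     c * \<xi> - link_sum (layer_links E1 E2) (\<lambda>i j. (norm (u i - u j))\<^sup>2)"

definition embedding_feasible ::
  "('a::finite \<times> 'b::finite) set \<Rightarrow> real \<Rightarrow> ('a + 'b \<Rightarrow> real ^ ('a + 'b)) \<Rightarrow> bool" where
  "embedding_feasible E3 \<xi> u \<longleftrightarrow>
     (\<Sum>i\<in>UNIV. (norm (u i))\<^sup>2) = 1 \<and> (\<Sum>i\<in>UNIV. u i) = 0 \<and>
     (\<forall>(i, j)\<in>E3. (norm (u (Inl i) - u (Inr j)))\<^sup>2 \<le> - \<xi>)"

definition embedding_optimal ::
  "'a::finite set set \<Rightarrow> 'b::finite set set \<Rightarrow> ('a \<times> 'b) set \<Rightarrow> real \<Rightarrow>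
     real \<Rightarrow> ('a + 'b \<Rightarrow> real ^ ('a + 'b)) \<Rightarrow> bool" where
  "embedding_optimal E1 E2 E3 c \<xi> u \<longleftrightarrow> embedding_feasible E3 \<xi> u \<and>
     (\<forall>\<xi>' u'. embedding_feasible E3 \<xi>' u' \<longrightarrow>
        embedding_objective E1 E2 c \<xi>' u' \<le> embedding_objective E1 E2 c \<xi> u)"

definition two_point_embedding :: "real ^ ('a + 'b) \<Rightarrow> 'a::finite + 'b::finite \<Rightarrow> real ^ ('a + 'b)" where
  "two_point_embedding h v = (case v of
       Inl i \<Rightarrow> real CARD('b) *\<^sub>R h
     | Inr j \<Rightarrow> - (real CARD('a) *\<^sub>R h))"

end

(*
  Every admissible weight matrix W of budget c bounds the embedding objective from above by
  -lambda_2(L(W)), and the two-point embedding has the value -(1/n + 1/m) c. So it suffices to find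
  W with x . L(W) x >= (1/n + 1/m) c |x|^2 for all x orthogonal to 1. Among the matrices of budget at
  most c with this property for their own budget, compactness gives one of largest budget s. If
  s < c, then the eigenvalues do not coalesce at s, so some optimal W has lambda_2 < lambda_3; the
  eigenvector of lambda_2 is (m 1, -n 1), and the gap to lambda_3 leaves room to add a small regular
  matrix, which contradicts the maximality of s. The same gap at c forces every coordinate of an
  optimal embedding to be a multiple of (m 1, -n 1).
*)
theory Submission
  imports Defs
begin

subsection \<open>Spectral theory of symmetric matrices\<close>

lemma symmetric_dot_commute:
  fixes A :: "real ^ 'v ^ 'v::finite"
  assumes "transpose A = A"
  shows "x \<bullet> (A *v y) = (A *v x) \<bullet> y"
  by (metis assms dot_lmul_matrix vector_transpose_matrix)

text \<open>First variation: moving from \<open>v\<close> by \<open>t\<close> times the residual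
  \<open>y\<close> changes the nonnegative quantity
  \<open>x \<bullet> (A *v x) - l * (x \<bullet> x)\<close> from 0 to
  \<open>2 * t * b + t\<^sup>2 * q\<close> with \<open>b = y \<bullet> y\<close>, so
  \<open>b\<close> must vanish. Invariance of \<open>S\<close> keeps the residual inside
  \<open>S\<close>.\<close>

lemma rayleigh_minimizer_eigenvector:
  fixes A :: "real ^ 'v ^ 'v::finite"
  assumes sym: "transpose A = A" and S: "subspace S" and inv: "\<And>x. x \<in> S \<Longrightarrow> A *v x \<in> S"
    and ge: "\<And>x. x \<in> S \<Longrightarrow> l * (x \<bullet> x) \<le> x \<bullet> (A *v x)"
    and v: "v \<in> S" and eq: "v \<bullet> (A *v v) = l * (v \<bullet> v)"
  shows "A *v v = l *\<^sub>R v"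
proof -
  define y where "y = A *v v - l *\<^sub>R v"
  define b where "b = y \<bullet> y"
  define q where "q = y \<bullet> (A *v y) - l * (y \<bullet> y)"
  have y: "y \<in> S"
    unfolding y_def using S inv v by (simp add: subspace_diff subspace_scale)
  have yv: "y \<bullet> (A *v v) = b + l * (y \<bullet> v)"
    unfolding b_def by (subst (3) y_def) (simp add: inner_diff_right)
  have q0: "q \<ge> 0" using ge[OF y] by (simp add: q_def)
  \<comment> \<open>Adding 1 keeps the denominator positive when \<open>q = 0\<close>; with this
    \<open>t\<close> the expansion collapses to \<open>- (t\<^sup>2 * (q + 2))\<close>.\<close>
  define t where "t = - b / (q + 1)"
  have b: "b = - t * (q + 1)" using q0 by (simp add: t_def)
  have "v + t *\<^sub>R y \<in> S" using S v y by (simp add: subspace_add subspace_scale)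
  from ge[OF this] have "0 \<le> (v + t *\<^sub>R y) \<bullet> (A *v (v + t *\<^sub>R y)) - l * ((v + t *\<^sub>R y) \<bullet> (v + t *\<^sub>R y))"
    by simp
  also have "\<dots> = 2 * t * b + t\<^sup>2 * q"
    using yv eq symmetric_dot_commute[OF sym, of v y]
    by (simp add: matrix_vector_right_distrib matrix_vector_mult_scaleR inner_add_left inner_add_right
          q_def algebra_simps power2_eq_square inner_commute)
  also have "\<dots> = - (t\<^sup>2 * (q + 2))"
    by (simp add: b algebra_simps power2_eq_square)
  finally have "t = 0"
    using q0 by (simp add: mult_le_0_iff)
  then have "b = 0" using b by simp
  then show ?thesis by (simp add: b_def y_def)
qed

text \<open>The Rayleigh quotient attains its minimum on the compact unit sphere of
  \<open>S\<close>, and a minimizer is an eigenvector.\<close>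

lemma eigenvector_in_invariant_subspace:
  fixes A :: "real ^ 'v ^ 'v::finite"
  assumes sym: "transpose A = A" and S: "subspace S" and inv: "\<And>x. x \<in> S \<Longrightarrow> A *v x \<in> S"
    and ne: "y \<in> S" "y \<noteq> 0"
  obtains v l where "v \<in> S" "v \<noteq> 0" "A *v v = l *\<^sub>R v"
proof -
  let ?K = "S \<inter> sphere 0 1"
  have "compact ?K" using S closed_subspace by (intro closed_Int_compact) auto
  moreover have "(1 / norm y) *\<^sub>R y \<in> ?K" using ne S by (simp add: subspace_scale)
  then have "?K \<noteq> {}" by blast
  moreover have "continuous_on ?K (\<lambda>x. x \<bullet> (A *v x))"
    by (intro continuous_intros)
  ultimately have "\<exists>v\<in>?K. \<forall>x\<in>?K. v \<bullet> (A *v v) \<le> x \<bullet> (A *v x)"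
    by (rule continuous_attains_inf)
  then obtain v where v: "v \<in> ?K" and min: "\<And>x. x \<in> ?K \<Longrightarrow> v \<bullet> (A *v v) \<le> x \<bullet> (A *v x)"
    by blast
  have ge: "v \<bullet> (A *v v) * (x \<bullet> x) \<le> x \<bullet> (A *v x)" if "x \<in> S" for x
  proof (cases "x = 0")
    case False
    then have "(1 / norm x) *\<^sub>R x \<in> ?K" using that S by (simp add: subspace_scale)
    from min[OF this] False show ?thesis
      by (simp add: matrix_vector_mult_scaleR dot_square_norm field_simps power2_eq_square)
  qed simp
  have "v \<bullet> v = 1" using v by (simp add: dot_square_norm)
  then have "A *v v = (v \<bullet> (A *v v)) *\<^sub>R v"
    using rayleigh_minimizer_eigenvector[OF sym S inv ge, of v] v by simp
  with v show thesis by (intro that[of v]) auto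
qed

section \<open>Eigenspaces, ordered eigenbasis and variational bounds\<close>

lemma subspace_eigenspace: "subspace (eigenspace A x)"
  by (auto simp: subspace_def eigenspace_def matrix_vector_right_distrib
      matrix_vector_mult_scaleR scaleR_add_right)

lemma eigenspaces_orthogonal:
  fixes A :: "real ^ 'v ^ 'v::finite"
  assumes "transpose A = A" "v \<in> eigenspace A x" "w \<in> eigenspace A y" "x \<noteq> y"
  shows "v \<bullet> w = 0"
  using symmetric_dot_commute[OF assms(1), of v w] assms by (simp add: eigenspace_def)

text \<open>One nonzero eigenvector per eigenvalue gives a pairwise orthogonal, hence finite, set;
  orthogonality also makes the choice injective.\<close>

lemma finite_eigenvalues:
  fixes A :: "real ^ 'v ^ 'v::finite"
  assumes sym: "transpose A = A"
  shows "finite {x. \<exists>v\<in>eigenspace A x. v \<noteq> 0}" (is "finite ?E")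
proof -
  obtain f where f: "\<And>x. x \<in> ?E \<Longrightarrow> f x \<in> eigenspace A x \<and> f x \<noteq> 0"
    using bchoice[of ?E "\<lambda>x v. v \<in> eigenspace A x \<and> v \<noteq> 0"] by blast
  have orth: "f x \<bullet> f y = 0" if "x \<in> ?E" "y \<in> ?E" "x \<noteq> y" for x y
    using f that by (blast intro: eigenspaces_orthogonal[OF sym, of _ x _ y])
  then have "pairwise orthogonal (f ` ?E)"
    by (auto simp: pairwise_def orthogonal_def)
  then have "finite (f ` ?E)" by (rule pairwise_orthogonal_imp_finite)
  moreover have "inj_on f ?E"
  proof (rule inj_onI, rule ccontr)
    fix x y assume "x \<in> ?E" "y \<in> ?E" "f x = f y" "x \<noteq> y"
    then show False using orth[of x y] f[of x] by simp
  qed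
  ultimately show ?thesis by (rule finite_imageD)
qed

text \<open>Spectral theorem in the indexing of \<open>ordered_eigenvalues\<close>: orthonormal
  bases of the eigenspaces are strung together in increasing order of eigenvalue. The orthogonal
  complement of all these vectors is invariant, so if it were nonzero it would contain a further
  eigenvector.\<close>

lemma ordered_eigenvalues_eigenbasis:
  fixes A :: "real ^ 'v ^ 'v::finite"
  assumes sym: "transpose A = A"
  obtains b :: "nat \<Rightarrow> real ^ 'v" where
    "length (ordered_eigenvalues A) = CARD('v)" "sorted (ordered_eigenvalues A)"
    "\<And>i. i < CARD('v) \<Longrightarrow> A *v b i = (ordered_eigenvalues A ! i) *\<^sub>R b i"
    "\<And>i j. i < CARD('v) \<Longrightarrow> j < CARD('v) \<Longrightarrow> b i \<bullet> b j = (if i = j then 1 else 0)"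
    "\<And>x. (\<Sum>i<CARD('v). (b i \<bullet> x) *\<^sub>R b i) = x"
proof -
  let ?E = "{x. \<exists>v\<in>eigenspace A x. v \<noteq> 0}"
  define evs where "evs = sorted_list_of_set ?E"
  have evs: "set evs = ?E" "distinct evs" "sorted evs"
    using finite_eigenvalues[OF sym] by (auto simp: evs_def)
  have "\<exists>l. distinct l \<and> pairwise orthogonal (set l) \<and> (\<forall>v\<in>set l. norm v = 1) \<and>
     length l = dim (eigenspace A x) \<and> span (set l) = eigenspace A x" for x
  proof -
    obtain B where "pairwise orthogonal B" "\<And>x. x \<in> B \<Longrightarrow> norm x = 1" "independent B"
        "card B = dim (eigenspace A x)" "span B = eigenspace A x"
      using orthonormal_basis_subspace[OF subspace_eigenspace] by metis
    moreover then obtain l where "set l = B" "distinct l"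
      using finite_distinct_list independent_imp_finite by metis
    ultimately show ?thesis using distinct_card by metis
  qed
  then obtain l where l: "\<And>x. distinct (l x)" "\<And>x. pairwise orthogonal (set (l x))"
      "\<And>x v. v \<in> set (l x) \<Longrightarrow> norm v = 1" "\<And>x. length (l x) = dim (eigenspace A x)"
      "\<And>x. span (set (l x)) = eigenspace A x" by metis
  have l_eig: "v \<in> eigenspace A x" if "v \<in> set (l x)" for v x
    using that l(5) span_base by metis
  \<comment> \<open>Pairing each basis vector with its eigenvalue makes the first components
    reproduce \<open>ordered_eigenvalues A\<close> position by position.\<close>
  define ps where "ps = concat (map (\<lambda>x. map (Pair x) (l x)) evs)"
  have fst_ps: "map fst ps = ordered_eigenvalues A"
    by (simp add: ps_def ordered_eigenvalues_def evs_def map_concat o_def map_replicate_const l(4))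
  have ps: "v \<in> set (l x) \<and> x \<in> ?E" if "(x, v) \<in> set ps" for x v
    using that evs(1) by (auto simp: ps_def)
  have orth: "v \<bullet> w = (if (x, v) = (y, w) then 1 else 0)" if "(x, v) \<in> set ps" "(y, w) \<in> set ps" for x v y w
  proof (cases "x = y")
    case True
    moreover have "v \<in> set (l x)" "w \<in> set (l y)" using ps that by blast+
    ultimately show ?thesis using l(2)[of x] l(3)[of v x]
      by (auto simp: pairwise_def orthogonal_def dot_square_norm)
  next
    case False
    then show ?thesis
      using eigenspaces_orthogonal[OF sym _ _ False, of v w] l_eig ps[OF that(1)] ps[OF that(2)] by simp
  qed
  have dist_ps: "distinct ps"
  proof -
    have "distinct (concat (map (\<lambda>x. map (Pair x) (l x)) zs))" if "distinct zs" for zs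
      using that by (induction zs) (auto simp: distinct_map l(1) inj_on_def)
    then show ?thesis using evs(2) by (simp add: ps_def)
  qed
  define b where "b = (\<lambda>i. snd (ps ! i))"
  have b_in: "(fst (ps ! i), b i) \<in> set ps" if "i < length ps" for i
    using that by (simp add: b_def)
  have on: "b i \<bullet> b j = (if i = j then 1 else 0)" if "i < length ps" "j < length ps" for i j
  proof -
    have "b i \<bullet> b j = (if ps ! i = ps ! j then 1 else 0)"
      using orth[OF b_in[OF that(1)] b_in[OF that(2)]] by (simp add: b_def)
    then show ?thesis using dist_ps that by (simp add: nth_eq_iff_index_eq)
  qed
  have eig: "A *v b i = fst (ps ! i) *\<^sub>R b i" if "i < length ps" for i
    using l_eig ps[OF b_in[OF that]] by (auto simp: eigenspace_def)
  \<comment> \<open>Completeness: an eigenvector orthogonal to every \<open>b i\<close> lies in an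
    eigenspace spanned by some of them, hence is orthogonal to itself.\<close>
  have zero: "y = 0" if y: "\<And>i. i < length ps \<Longrightarrow> b i \<bullet> y = 0" for y
  proof (rule ccontr)
    assume "y \<noteq> 0"
    define S where "S = {z. \<forall>i<length ps. b i \<bullet> z = 0}"
    have S: "subspace S" by (auto simp: S_def subspace_def inner_add_right)
    have inv: "A *v x \<in> S" if "x \<in> S" for x
      using that eig by (auto simp: S_def symmetric_dot_commute[OF sym])
    have "y \<in> S" using y by (simp add: S_def)
    from eigenvector_in_invariant_subspace[OF sym S inv this \<open>y \<noteq> 0\<close>]
    obtain v x where v: "v \<in> S" "v \<noteq> 0" "A *v v = x *\<^sub>R v" by metis
    then have vE: "v \<in> eigenspace A x" "x \<in> ?E" by (auto simp: eigenspace_def)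
    have "w \<bullet> v = 0" if "w \<in> set (l x)" for w
    proof -
      have "(x, w) \<in> set ps" using that vE(2) evs(1) by (auto simp: ps_def)
      then obtain i where "i < length ps" "ps ! i = (x, w)" by (metis in_set_conv_nth)
      then show ?thesis using v(1) by (auto simp: S_def b_def)
    qed
    moreover have "v \<in> span (set (l x))" using vE(1) l(5) by metis
    ultimately have "orthogonal v v"
      by (metis orthogonal_to_span orthogonal_def inner_commute)
    then show False using v(2) by (simp add: orthogonal_def)
  qed
  have expand: "(\<Sum>i<length ps. (b i \<bullet> x) *\<^sub>R b i) = x" for x
  proof -
    have "x - (\<Sum>i<length ps. (b i \<bullet> x) *\<^sub>R b i) = 0"
    proof (rule zero)
      fix j assume j: "j < length ps"
      have "b j \<bullet> (\<Sum>i<length ps. (b i \<bullet> x) *\<^sub>R b i) = (\<Sum>i<length ps. if i = j then b j \<bullet> x else 0)"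
        unfolding inner_sum_right using j by (intro sum.cong) (auto simp: on)
      then show "b j \<bullet> (x - (\<Sum>i<length ps. (b i \<bullet> x) *\<^sub>R b i)) = 0"
        using j by (simp add: inner_diff_right)
    qed
    then show ?thesis by simp
  qed
  have inj: "inj_on b {..<length ps}"
    by (rule inj_onI) (metis on lessThan_iff zero_neq_one)
  have "independent (b ` {..<length ps})"
    using on by (intro pairwise_orthogonal_independent) (fastforce simp: pairwise_def orthogonal_def)+
  moreover have "x \<in> span (b ` {..<length ps})" for x
    by (subst expand[of x, symmetric]) (intro span_sum span_scale span_base imageI)
  then have "span (b ` {..<length ps}) = UNIV" by blast
  ultimately have "card (b ` {..<length ps}) = CARD('v)"
    by (metis dim_UNIV dim_eq_card_independent dim_span DIM_cart DIM_real mult_1_right)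
  then have len: "length ps = CARD('v)" using inj by (simp add: card_image)
  have sorted: "sorted (ordered_eigenvalues A)"
  proof -
    have "sorted (concat (map (\<lambda>x. replicate (d x) x) zs))" if "sorted zs" for zs and d :: "real \<Rightarrow> nat"
      using that by (induction zs) (auto simp: sorted_append)
    then show ?thesis using evs(3) by (simp add: ordered_eigenvalues_def evs_def)
  qed
  have length: "length (ordered_eigenvalues A) = CARD('v)"
    using len by (simp flip: fst_ps)
  have nth: "A *v b i = (ordered_eigenvalues A ! i) *\<^sub>R b i" if "i < CARD('v)" for i
    using eig that by (simp add: len flip: fst_ps)
  show thesis
    by (rule that[OF length sorted nth on[unfolded len] expand[unfolded len]])
qed

text \<open>Half of Courant-Fischer: the plane of the first two eigenvectors contains a nonzero
  vector orthogonal to \<open>y\<close>, whose Rayleigh quotient is at most the second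
  eigenvalue.\<close>

lemma second_eigval_ge:
  fixes A :: "real ^ 'v ^ 'v::finite"
  assumes sym: "transpose A = A" and card: "2 \<le> CARD('v)"
    and ge: "\<And>x. x \<bullet> y = 0 \<Longrightarrow> r * (x \<bullet> x) \<le> x \<bullet> (A *v x)"
  shows "r \<le> eigval 2 A"
proof -
  let ?l = "ordered_eigenvalues A"
  obtain b where len: "length ?l = CARD('v)" and sorted: "sorted ?l"
    and eig: "\<And>i. i < CARD('v) \<Longrightarrow> A *v b i = (?l ! i) *\<^sub>R b i"
    and on: "\<And>i j. i < CARD('v) \<Longrightarrow> j < CARD('v) \<Longrightarrow> b i \<bullet> b j = (if i = j then 1 else 0)"
    and expand: "\<And>x. (\<Sum>i<CARD('v). (b i \<bullet> x) *\<^sub>R b i) = x"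
    by (rule ordered_eigenvalues_eigenbasis[OF sym]) blast
  have b: "b 0 \<bullet> b 0 = 1" "b 1 \<bullet> b 1 = 1" "b 0 \<bullet> b 1 = 0" "b 1 \<bullet> b 0 = 0"
    using on card by auto
  have Ab: "A *v b 0 = (?l ! 0) *\<^sub>R b 0" "A *v b 1 = (?l ! 1) *\<^sub>R b 1"
    using eig card by auto
  have le: "?l ! 0 \<le> ?l ! 1" using sorted card len by (simp add: sorted_nth_mono)
  \<comment> \<open>Coefficients of a nonzero combination of \<open>b 0\<close> and
    \<open>b 1\<close> orthogonal to \<open>y\<close>. In the zero-based list, \<open>?l ! 1\<close>
    is \<open>eigval 2 A\<close>.\<close>
  obtain s t :: real where st: "s * (b 0 \<bullet> y) + t * (b 1 \<bullet> y) = 0" "s\<^sup>2 + t\<^sup>2 > 0"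
  proof (cases "b 0 \<bullet> y = 0 \<and> b 1 \<bullet> y = 0")
    case True
    then show thesis using that[of 0 1] by simp
  next
    case False
    then show thesis
      using that[of "b 1 \<bullet> y" "- (b 0 \<bullet> y)"] by (auto simp: sum_power2_gt_zero_iff mult.commute)
  qed
  have "(s *\<^sub>R b 0 + t *\<^sub>R b 1) \<bullet> y = 0" using st by (simp add: inner_add_left)
  from ge[OF this] have "r * (s\<^sup>2 + t\<^sup>2) \<le> ?l ! 0 * s\<^sup>2 + ?l ! 1 * t\<^sup>2"
    using b by (simp add: matrix_vector_right_distrib matrix_vector_mult_scaleR Ab inner_add_left
        inner_add_right power2_eq_square algebra_simps del: One_nat_def)
  also have "\<dots> \<le> ?l ! 1 * (s\<^sup>2 + t\<^sup>2)"
    using le by (simp add: distrib_left mult_right_mono)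
  finally show ?thesis using st(2) by (simp add: eigval_def)
qed

text \<open>Meant for the all-ones vector as \<open>k\<close> and \<open>layer_vector\<close> as
  \<open>v\<close>. As \<open>r\<close> is at most the second eigenvalue, \<open>v\<close> minimizes
  the Rayleigh quotient on the complement of \<open>k\<close> and is an eigenvector. Both
  \<open>k\<close> and \<open>v\<close> then belong to eigenvalues below the third, so they span the
  plane of \<open>b 0\<close> and \<open>b 1\<close>.\<close>

lemma eigval_gap:
  fixes A :: "real ^ 'v ^ 'v::finite"
  assumes sym: "transpose A = A" and psd: "\<And>x. 0 \<le> x \<bullet> (A *v x)" and card: "3 \<le> CARD('v)"
    and ker: "A *v k = 0" "k \<noteq> 0"
    and v: "v \<noteq> 0" "v \<bullet> k = 0" "v \<bullet> (A *v v) = r * (v \<bullet> v)" and r: "0 \<le> r"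
    and r2: "r \<le> eigval 2 A" and simple: "eigval 2 A \<noteq> eigval 3 A"
  shows "A *v v = r *\<^sub>R v" and "r < eigval 3 A"
    and "\<And>y. y \<bullet> k = 0 \<Longrightarrow> y \<bullet> v = 0 \<Longrightarrow> eigval 3 A * (y \<bullet> y) \<le> y \<bullet> (A *v y)"
proof -
  let ?l = "ordered_eigenvalues A" and ?N = "CARD('v)"
  obtain b where len: "length ?l = CARD('v)" and sorted: "sorted ?l"
    and eig: "\<And>i. i < CARD('v) \<Longrightarrow> A *v b i = (?l ! i) *\<^sub>R b i"
    and on: "\<And>i j. i < CARD('v) \<Longrightarrow> j < CARD('v) \<Longrightarrow> b i \<bullet> b j = (if i = j then 1 else 0)"
    and expand: "\<And>x. (\<Sum>i<CARD('v). (b i \<bullet> x) *\<^sub>R b i) = x"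
    by (rule ordered_eigenvalues_eigenbasis[OF sym]) blast
  have parseval: "x \<bullet> y = (\<Sum>i<?N. (b i \<bullet> x) * (b i \<bullet> y))" for x y
    by (subst expand[of x, symmetric]) (simp add: inner_sum_left)
  have bA: "b i \<bullet> (A *v x) = ?l ! i * (b i \<bullet> x)" if "i < ?N" for i x
    using eig[OF that] by (simp add: symmetric_dot_commute[OF sym])
  have quad: "x \<bullet> (A *v x) = (\<Sum>i<?N. ?l ! i * (b i \<bullet> x)\<^sup>2)" for x
    unfolding parseval[of x "A *v x"] by (rule sum.cong) (auto simp: bA power2_eq_square)
  have l12: "?l ! 1 < ?l ! 2"
    using sorted card len simple sorted_nth_mono[of ?l 1 2] by (simp add: eigval_def)
  show r3: "r < eigval 3 A" using r2 l12 by (simp add: eigval_def)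
  have l2: "?l ! 2 \<le> ?l ! i" if "2 \<le> i" "i < ?N" for i
    using sorted_nth_mono[OF sorted that(1)] that len by simp
  have l1: "r \<le> ?l ! i" if "1 \<le> i" "i < ?N" for i
    using sorted_nth_mono[OF sorted that(1)] that len r2 by (simp add: eigval_def)
  have l0: "0 \<le> ?l ! 0" using psd[of "b 0"] eig[of 0] on[of 0 0] card by simp
  have ge: "r * (x \<bullet> x) \<le> x \<bullet> (A *v x)" if x: "x \<bullet> k = 0" for x
  proof -
    \<comment> \<open>For \<open>r > 0\<close> the vector \<open>k\<close> is a multiple of
      \<open>b 0\<close>, so the \<open>b 0\<close> coefficient of \<open>x\<close> vanishes; for
      \<open>r = 0\<close> nonnegativity of the first eigenvalue is enough.\<close>
    have "r * (b i \<bullet> x)\<^sup>2 \<le> ?l ! i * (b i \<bullet> x)\<^sup>2" if i: "i < ?N" for i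
    proof (cases "i = 0 \<and> r \<noteq> 0")
      case True
      have "b j \<bullet> k = 0" if "j \<noteq> 0" "j < ?N" for j
        using bA[of j k] l1[of j] that ker True r by simp
      then have "z \<bullet> k = (b 0 \<bullet> z) * (b 0 \<bullet> k)" for z
        unfolding parseval[of z k] using card by (subst sum.remove[of _ 0]) auto
      from this[of x] this[of k] have "b 0 \<bullet> x = 0" using x ker(2) by auto
      then show ?thesis using True by simp
    next
      case False
      then have "r \<le> ?l ! i" using l0 l1[of i] i by (cases "i = 0") auto
      then show ?thesis by (rule mult_right_mono) simp
    qed
    then show ?thesis
      unfolding quad parseval[of x x] sum_distrib_left by (intro sum_mono) (simp add: power2_eq_square)
  qed
  have "subspace {x. x \<bullet> k = 0}" by (auto simp: subspace_def inner_add_left)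
  from rayleigh_minimizer_eigenvector[OF sym this _ _ _ v(3)]
  show Av: "A *v v = r *\<^sub>R v"
    using ge v(2) ker by (simp flip: symmetric_dot_commute[OF sym])
  have k0: "b i \<bullet> k = 0" if "2 \<le> i" "i < ?N" for i
    using bA[of i k] l2[of i] that ker r r3 by (simp add: eigval_def)
  have v0: "b i \<bullet> v = 0" if "2 \<le> i" "i < ?N" for i
    using bA[of i v] l2[of i] that Av r r3 by (simp add: eigval_def)
  have two: "y \<bullet> z = (b 0 \<bullet> y) * (b 0 \<bullet> z) + (b 1 \<bullet> y) * (b 1 \<bullet> z)"
    if "\<And>i. 2 \<le> i \<Longrightarrow> i < ?N \<Longrightarrow> b i \<bullet> z = 0" for y z
  proof -
    have "y \<bullet> z = (\<Sum>i<2. (b i \<bullet> y) * (b i \<bullet> z))"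
      unfolding parseval[of y z] using card that
      by (intro sum.mono_neutral_right) (auto simp: not_less)
    then show ?thesis by (simp add: numeral_2_eq_2)
  qed
  have k2: "y \<bullet> k = (b 0 \<bullet> y) * (b 0 \<bullet> k) + (b 1 \<bullet> y) * (b 1 \<bullet> k)"
    and v2: "y \<bullet> v = (b 0 \<bullet> y) * (b 0 \<bullet> v) + (b 1 \<bullet> y) * (b 1 \<bullet> v)" for y
    using two[of k y] two[of v y] k0 v0 by blast+
  show "eigval 3 A * (y \<bullet> y) \<le> y \<bullet> (A *v y)" if y: "y \<bullet> k = 0" "y \<bullet> v = 0" for y
  proof -
    \<comment> \<open>For \<open>r = 0\<close> the eigenvalue 0 is repeated, so \<open>k\<close> and
      \<open>v\<close> may be skew to \<open>b 0\<close> and \<open>b 1\<close>. The square of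
      \<open>?D\<close> is the Gram determinant of \<open>k\<close> and \<open>v\<close>; it is
      nonzero, and Cramer's rule kills both coordinates of \<open>y\<close>.\<close>
    let ?D = "(b 0 \<bullet> k) * (b 1 \<bullet> v) - (b 1 \<bullet> k) * (b 0 \<bullet> v)"
    have e: "(b 0 \<bullet> y) * (b 0 \<bullet> k) + (b 1 \<bullet> y) * (b 1 \<bullet> k) = 0"
      "(b 0 \<bullet> y) * (b 0 \<bullet> v) + (b 1 \<bullet> y) * (b 1 \<bullet> v) = 0"
      using k2[of y] v2[of y] y by auto
    have "?D\<^sup>2 = (k \<bullet> k) * (v \<bullet> v) - (v \<bullet> k)\<^sup>2"
      using k2[of k] v2[of v] k2[of v] by algebra
    then have D: "?D \<noteq> 0" using v ker(2) by auto
    have "(b 0 \<bullet> y) * ?D = 0" "(b 1 \<bullet> y) * ?D = 0" using e by algebra+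
    then have y01: "b 0 \<bullet> y = 0" "b 1 \<bullet> y = 0" using D by auto
    have "?l ! 2 * (b i \<bullet> y)\<^sup>2 \<le> ?l ! i * (b i \<bullet> y)\<^sup>2" if "i < ?N" for i
    proof -
      consider "i = 0" | "i = 1" | "2 \<le> i" by linarith
      then show ?thesis using y01 l2[of i] that by cases (auto intro: mult_right_mono)
    qed
    then show ?thesis
      unfolding quad parseval[of y y] sum_distrib_left
      by (intro sum_mono) (simp add: power2_eq_square eigval_def)
  qed
qed

subsection \<open>The quadratic form of a network Laplacian\<close>

lemma norm_power2_coordinates:
  fixes v :: "real ^ 'k::finite"
  shows "(norm v)\<^sup>2 = (\<Sum>k\<in>UNIV. v $ k * v $ k)"
  by (simp add: power2_norm_eq_inner inner_vec_def)

lemma sum_UNIV_sum_type: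
  fixes f :: "'a::finite + 'b::finite \<Rightarrow> 'c::comm_monoid_add"
  shows "(\<Sum>p\<in>UNIV. f p) = (\<Sum>i\<in>UNIV. f (Inl i)) + (\<Sum>j\<in>UNIV. f (Inr j))"
  by (simp add: UNIV_Plus_UNIV[symmetric] sum.Plus del: UNIV_Plus_UNIV)

lemma link_sum_indicator:
  fixes E :: "'v::finite set set"
  shows "link_sum E f = (\<Sum>i\<in>UNIV. \<Sum>j\<in>UNIV. if {i, j} \<in> E then f i j else 0) / 2"
proof -
  have "(\<Sum>(i, j)\<in>{(i, j). {i, j} \<in> E}. f i j)
      = (\<Sum>(i, j)\<in>UNIV. if {i, j} \<in> E then f i j else 0)"
    by (rule sum.mono_neutral_cong_left) (auto split: if_splits)
  then show ?thesis
    unfolding link_sum_def by (simp add: sum.cartesian_product)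
qed

lemma link_sum_sum: "link_sum E (\<lambda>i j. \<Sum>k\<in>K. f k i j) = (\<Sum>k\<in>K. link_sum E (f k))"
  unfolding link_sum_def case_prod_unfold by (subst sum.swap) (simp add: sum_divide_distrib)

lemma link_sum_nonneg: "(\<And>i j. 0 \<le> f i j) \<Longrightarrow> 0 \<le> link_sum E f"
  by (auto simp: link_sum_def intro!: sum_nonneg divide_nonneg_nonneg)

lemma link_sum_layer_links:
  fixes E1 :: "'a::finite set set" and E2 :: "'b::finite set set"
  shows "link_sum (layer_links E1 E2) f =
    link_sum E1 (\<lambda>i j. f (Inl i) (Inl j)) + link_sum E2 (\<lambda>i j. f (Inr i) (Inr j))"
proof -
  have inl: "{Inl i, Inl j} \<in> layer_links E1 E2 \<longleftrightarrow> {i, j} \<in> E1" for i j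
  proof -
    have "{Inl i, Inl j :: 'a + 'b} = Inl ` e \<longleftrightarrow> {i, j} = e" for e
      using inj_image_eq_iff[OF inj_Inl, of "{i, j}" e] by simp
    moreover have "{Inl i, Inl j :: 'a + 'b} \<noteq> Inr ` e" for e by auto
    ultimately show ?thesis
      unfolding layer_links_def by (simp add: image_iff)
  qed
  have inr: "{Inr i, Inr j} \<in> layer_links E1 E2 \<longleftrightarrow> {i, j} \<in> E2" for i j
  proof -
    have "{Inr i, Inr j :: 'a + 'b} = Inr ` e \<longleftrightarrow> {i, j} = e" for e
      using inj_image_eq_iff[OF inj_Inr, of "{i, j}" e] by simp
    moreover have "{Inr i, Inr j :: 'a + 'b} \<noteq> Inl ` e" for e by auto
    ultimately show ?thesis
      unfolding layer_links_def by (simp add: image_iff)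
  qed
  have mixed: "{Inl i, Inr j} \<notin> layer_links E1 E2" "{Inr j, Inl i} \<notin> layer_links E1 E2" for i j
    by (auto simp: layer_links_def)
  show ?thesis
    by (simp add: link_sum_indicator sum_UNIV_sum_type inl inr mixed add_divide_distrib)
qed

text \<open>Summation by parts: exchanging the indices in the double sum and averaging the two
  versions turns \<open>f i\<close> into \<open>f i - f j\<close>. The average supplies the factor
  1/2 in \<open>link_sum\<close>.\<close>

lemma laplacian_form:
  fixes E :: "'v::finite set set"
  assumes "simple_graph E"
  shows "(\<Sum>i\<in>UNIV. f i * (\<Sum>j\<in>UNIV. laplacian E $ i $ j * g j))
    = link_sum E (\<lambda>i j. (f i - f j) * (g i - g j))"
proof -
  define a :: "'v \<Rightarrow> 'v \<Rightarrow> real" where "a i j = (if {i, j} \<in> E then 1 else 0)" for i j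
  have a_sym: "a i j = a j i" for i j by (simp add: a_def insert_commute)
  have a_diag: "{i} \<notin> E" for i using assms by (force simp: simple_graph_def)
  have deg: "real (card {k. {i, k} \<in> E}) = (\<Sum>k\<in>UNIV. a i k)" for i
    by (simp add: a_def sum.If_cases)
  have lap: "laplacian E $ i $ j = (if i = j then (\<Sum>k\<in>UNIV. a i k) else 0) - a i j" for i j
    using a_diag deg by (auto simp: laplacian_def a_def)
  have "(\<Sum>j\<in>UNIV. laplacian E $ i $ j * g j) = (\<Sum>j\<in>UNIV. a i j * (g i - g j))" for i
    by (simp add: lap left_diff_distrib right_diff_distrib sum_subtractf if_distrib[of "\<lambda>x. x * _"]
        sum_distrib_right cong: if_cong)
  then have S: "(\<Sum>i\<in>UNIV. f i * (\<Sum>j\<in>UNIV. laplacian E $ i $ j * g j))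
      = (\<Sum>i\<in>UNIV. \<Sum>j\<in>UNIV. a i j * (f i * (g i - g j)))" (is "?L = ?S")
    by (simp add: sum_distrib_left mult_ac)
  have "?S = (\<Sum>i\<in>UNIV. \<Sum>j\<in>UNIV. a i j * (f j * (g j - g i)))"
    by (subst sum.swap) (simp add: a_sym)
  moreover have "?S + (\<Sum>i\<in>UNIV. \<Sum>j\<in>UNIV. a i j * (f j * (g j - g i))) =
      (\<Sum>i\<in>UNIV. \<Sum>j\<in>UNIV. a i j * ((f i - f j) * (g i - g j)))"
    unfolding sum.distrib[symmetric] by (intro sum.cong refl) (simp add: algebra_simps)
  ultimately have "2 * ?S = (\<Sum>i\<in>UNIV. \<Sum>j\<in>UNIV. a i j * ((f i - f j) * (g i - g j)))"
    by linarith
  then have "?S = link_sum E (\<lambda>i j. (f i - f j) * (g i - g j))"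
    unfolding link_sum_indicator by (simp add: a_def if_distrib[of "\<lambda>x. x * _"] cong: if_cong)
  with S show ?thesis by simp
qed

text \<open>The Dirichlet form of the weighted network, kept bilinear so that eigenvector equations
  can be tested against an arbitrary \<open>y\<close>. It is affine in \<open>W\<close>, which makes
  continuity and adding weights immediate.\<close>

definition network_form ::
  "'a::finite set set \<Rightarrow> 'b::finite set set \<Rightarrow> real ^ 'b ^ 'a \<Rightarrow>
    real ^ ('a + 'b) \<Rightarrow> real ^ ('a + 'b) \<Rightarrow> real" where
  "network_form E1 E2 W y x =
     link_sum (layer_links E1 E2) (\<lambda>p q. (y $ p - y $ q) * (x $ p - x $ q)) +
     (\<Sum>i\<in>UNIV. \<Sum>j\<in>UNIV. W $ i $ j * ((y $ Inl i - y $ Inr j) * (x $ Inl i - x $ Inr j)))"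

lemma network_laplacian_form:
  fixes E1 :: "'a::finite set set" and E2 :: "'b::finite set set"
  assumes "simple_graph E1" "simple_graph E2"
  shows "y \<bullet> (network_laplacian E1 E2 W *v x) = network_form E1 E2 W y x"
proof -
  have l: "(network_laplacian E1 E2 W *v x) $ Inl i =
      (\<Sum>j\<in>UNIV. laplacian E1 $ i $ j * x $ Inl j) + (\<Sum>j\<in>UNIV. W $ i $ j * (x $ Inl i - x $ Inr j))" for i
    by (simp add: network_laplacian_def matrix_vector_mult_def sum_UNIV_sum_type distrib_right
        sum.distrib if_distrib[of "\<lambda>x. x * _"] sum_distrib_right right_diff_distrib sum_subtractf
        sum_negf cong: if_cong)
  have r: "(network_laplacian E1 E2 W *v x) $ Inr j =
      (\<Sum>i\<in>UNIV. laplacian E2 $ j $ i * x $ Inr i) + (\<Sum>i\<in>UNIV. W $ i $ j * (x $ Inr j - x $ Inl i))" for j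
    by (simp add: network_laplacian_def matrix_vector_mult_def sum_UNIV_sum_type distrib_right
        sum.distrib if_distrib[of "\<lambda>x. x * _"] sum_distrib_right right_diff_distrib sum_subtractf
        sum_negf transpose_def cong: if_cong)
  have "(\<Sum>i\<in>UNIV. y $ Inl i * (\<Sum>j\<in>UNIV. W $ i $ j * (x $ Inl i - x $ Inr j))) +
      (\<Sum>j\<in>UNIV. y $ Inr j * (\<Sum>i\<in>UNIV. W $ i $ j * (x $ Inr j - x $ Inl i))) =
      (\<Sum>i\<in>UNIV. \<Sum>j\<in>UNIV. W $ i $ j * ((y $ Inl i - y $ Inr j) * (x $ Inl i - x $ Inr j)))"
    unfolding sum_distrib_left
    by (subst (2) sum.swap) (simp add: sum.distrib[symmetric] algebra_simps)
  then show ?thesis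
    by (simp add: inner_vec_def sum_UNIV_sum_type l r distrib_left sum.distrib network_form_def
        link_sum_layer_links laplacian_form[OF assms(1)] laplacian_form[OF assms(2)])
qed

lemma inner_one_matrix_one:
  fixes W :: "real ^ 'b::finite ^ 'a::finite"
  shows "(1 :: real ^ 'a) \<bullet> (W *v 1) = (\<Sum>i\<in>UNIV. \<Sum>j\<in>UNIV. W $ i $ j)"
  by (simp add: inner_vec_def matrix_vector_mult_def)

lemma transpose_network_laplacian:
  "transpose (network_laplacian E1 E2 W) = network_laplacian E1 E2 W"
  by (auto simp: vec_eq_iff transpose_def network_laplacian_def laplacian_def insert_commute
      split: sum.split)

lemma network_form_one: "network_form E1 E2 W y 1 = 0"
  by (simp add: network_form_def link_sum_def case_prod_unfold)

lemma network_form_nonneg: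
  assumes "\<And>i j. 0 \<le> W $ i $ j"
  shows "0 \<le> network_form E1 E2 W x x"
  using assms unfolding network_form_def
  by (auto intro!: add_nonneg_nonneg link_sum_nonneg sum_nonneg)

lemma network_form_add_weights:
  "network_form E1 E2 (W + V) y x = network_form E1 E2 W y x +
     (\<Sum>i\<in>UNIV. \<Sum>j\<in>UNIV. V $ i $ j * ((y $ Inl i - y $ Inr j) * (x $ Inl i - x $ Inr j)))"
  by (simp add: network_form_def distrib_right sum.distrib)

lemma continuous_on_network_form [continuous_intros]:
  "continuous_on S (\<lambda>W. network_form E1 E2 W y x)"
  unfolding network_form_def by (intro continuous_intros)

section \<open>The candidate eigenvector and regular weights\<close>

definition layer_vector :: "real ^ ('a::finite + 'b::finite)" where
  "layer_vector = (\<chi> v. case v of Inl i \<Rightarrow> real CARD('b) | Inr j \<Rightarrow> - real CARD('a))"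

lemma layer_vector_nth [simp]:
  "(layer_vector :: real ^ ('a::finite + 'b::finite)) $ Inl i = real CARD('b)"
  "(layer_vector :: real ^ ('a::finite + 'b::finite)) $ Inr j = - real CARD('a)"
  by (simp_all add: layer_vector_def)

lemma layer_vector_inner_one: "(layer_vector :: real ^ ('a::finite + 'b::finite)) \<bullet> 1 = 0"
  by (simp add: inner_vec_def sum_UNIV_sum_type)

lemma layer_vector_inner_self:
  "(layer_vector :: real ^ ('a::finite + 'b::finite)) \<bullet> layer_vector =
     real CARD('a) * real CARD('b) * (real CARD('a) + real CARD('b))"
  by (simp add: inner_vec_def sum_UNIV_sum_type algebra_simps)

text \<open>\<open>layer_vector\<close> is constant on each layer, so layer links contribute
  nothing, and it differs by the same amount across every interlayer link.\<close>

lemma network_form_layer_vector: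
  "network_form E1 E2 W y (layer_vector :: real ^ ('a::finite + 'b::finite)) =
     (real CARD('a) + real CARD('b)) *
     (\<Sum>i\<in>UNIV. \<Sum>j\<in>UNIV. W $ i $ j * (y $ Inl i - y $ Inr j))"
  unfolding network_form_def link_sum_layer_links
  by (simp add: link_sum_def sum_distrib_left sum_distrib_right mult_ac add.commute)

lemma layer_vector_nonzero: "(layer_vector :: real ^ ('a::finite + 'b::finite)) \<noteq> 0"
proof -
  have "(layer_vector :: real ^ ('a + 'b)) \<bullet> layer_vector > 0"
    unfolding layer_vector_inner_self by (intro mult_pos_pos add_pos_pos) simp_all
  then show ?thesis by auto
qed

lemma two_point_embedding_layer_vector:
  "two_point_embedding h v = layer_vector $ v *\<^sub>R h"
  by (simp add: two_point_embedding_def layer_vector_def split: sum.split)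

lemma regular_weights_sums:
  fixes W :: "real ^ 'b::finite ^ 'a::finite"
  assumes "regular_weights W" "(1 :: real ^ 'a) \<bullet> (W *v 1) = c"
  shows "(\<Sum>j\<in>UNIV. W $ i $ j) = c / real CARD('a)" "(\<Sum>i\<in>UNIV. W $ i $ j) = c / real CARD('b)"
proof -
  obtain r s where rs: "W *v 1 = r *\<^sub>R 1" "transpose W *v 1 = s *\<^sub>R 1"
    using assms(1) by (auto simp: regular_weights_def span_singleton)
  have r: "(\<Sum>j\<in>UNIV. W $ i $ j) = r" for i
    using arg_cong[OF rs(1), of "\<lambda>v. v $ i"] by (simp add: matrix_vector_mult_def)
  have s: "(\<Sum>i\<in>UNIV. W $ i $ j) = s" for j
    using arg_cong[OF rs(2), of "\<lambda>v. v $ j"] by (simp add: matrix_vector_mult_def transpose_def)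
  have "real CARD('a) * r = c" using assms(2) by (simp add: inner_one_matrix_one r)
  moreover have "real CARD('b) * s = c"
    using assms(2) unfolding inner_one_matrix_one by (subst (asm) sum.swap) (simp add: s)
  ultimately show "(\<Sum>j\<in>UNIV. W $ i $ j) = c / real CARD('a)" "(\<Sum>i\<in>UNIV. W $ i $ j) = c / real CARD('b)"
    unfolding r s by (auto simp: field_simps)
qed

subsection \<open>Budgets below the threshold\<close>

locale two_layer_network =
  fixes E1 :: "'a::finite set set" and E2 :: "'b::finite set set" and E3 :: "('a \<times> 'b) set"
  assumes simple1: "simple_graph E1" and simple2: "simple_graph E2"
    and feasible: "regularity_feasible E3"
begin

definition rate :: real where "rate = 1 / real CARD('a) + 1 / real CARD('b)"

abbreviation lap :: "real ^ 'b ^ 'a \<Rightarrow> real ^ ('a + 'b) ^ ('a + 'b)" where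
  "lap \<equiv> network_laplacian E1 E2"

abbreviation form :: "real ^ 'b ^ 'a \<Rightarrow> real ^ ('a + 'b) \<Rightarrow> real ^ ('a + 'b) \<Rightarrow> real" where
  "form \<equiv> network_form E1 E2"

abbreviation x0 :: "real ^ ('a + 'b)" where "x0 \<equiv> layer_vector"

text \<open>Variational form of the second eigenvalue being at least \<open>rate * c\<close>: a
  closed condition on \<open>W\<close>, and directly the one that the duality bound for embeddings
  uses.\<close>

definition attains_rate :: "real \<Rightarrow> real ^ 'b ^ 'a \<Rightarrow> bool" where
  "attains_rate c W \<longleftrightarrow> W \<in> weights E3 c \<and> (\<forall>x. x \<bullet> 1 = 0 \<longrightarrow> rate * c * (x \<bullet> x) \<le> form W x x)"

lemma rate_pos: "0 < rate"
  by (simp add: rate_def add_pos_pos)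

lemma rate_mult: "rate * (real CARD('a) * real CARD('b)) = real CARD('a) + real CARD('b)"
  by (simp add: rate_def field_simps)

lemmas lap_form = network_laplacian_form[OF simple1 simple2]

lemma lap_one: "lap W *v 1 = 0"
  using lap_form[of "lap W *v 1" W 1] by (simp add: network_form_one)

text \<open>The form at \<open>layer_vector\<close> sees \<open>W\<close> only through its total, so
  the Rayleigh quotient there is the same for every admissible matrix of budget
  \<open>c\<close>.\<close>

lemma form_layer_vector:
  assumes "W \<in> weights E3 c"
  shows "form W x0 x0 = rate * c * (x0 \<bullet> x0)"
proof -
  have "form W x0 x0 = c * (real CARD('a) + real CARD('b))\<^sup>2"
    using assms by (simp add: network_form_layer_vector weights_def inner_one_matrix_one
        power2_eq_square flip: sum_distrib_right)
  also have "\<dots> = rate * c * (x0 \<bullet> x0)"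
    unfolding layer_vector_inner_self by (simp add: power2_eq_square rate_mult[symmetric] mult_ac)
  finally show ?thesis .
qed

text \<open>Tested against \<open>y\<close>, constant row and column sums reduce the weighted sums
  to the plain layer sums of \<open>y\<close>, in the combination that \<open>y \<bullet> x0\<close>
  has.\<close>

lemma regular_eigenvector:
  assumes "W \<in> weights E3 c" "regular_weights W"
  shows "lap W *v x0 = (rate * c) *\<^sub>R x0"
proof -
  let ?n = "real CARD('a)" and ?m = "real CARD('b)"
  have c: "(1 :: real ^ 'a) \<bullet> (W *v 1) = c" using assms(1) by (simp add: weights_def)
  have "y \<bullet> (lap W *v x0) = y \<bullet> ((rate * c) *\<^sub>R x0)" for y
  proof -
    have "(\<Sum>i\<in>UNIV. \<Sum>j\<in>UNIV. W $ i $ j * y $ Inl i) = c / ?n * (\<Sum>i\<in>UNIV. y $ Inl i)"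
      by (simp add: regular_weights_sums[OF assms(2) c] sum_distrib_left flip: sum_distrib_right)
    moreover have "(\<Sum>i\<in>UNIV. \<Sum>j\<in>UNIV. W $ i $ j * y $ Inr j) = c / ?m * (\<Sum>j\<in>UNIV. y $ Inr j)"
      by (subst sum.swap)
        (simp add: regular_weights_sums[OF assms(2) c] sum_distrib_left flip: sum_distrib_right)
    moreover have "form W y x0 = (?n + ?m) *
        ((\<Sum>i\<in>UNIV. \<Sum>j\<in>UNIV. W $ i $ j * y $ Inl i) - (\<Sum>i\<in>UNIV. \<Sum>j\<in>UNIV. W $ i $ j * y $ Inr j))"
      by (simp add: network_form_layer_vector right_diff_distrib sum_subtractf)
    ultimately have "form W y x0 = (?n + ?m) *
        (c / ?n * (\<Sum>i\<in>UNIV. y $ Inl i) - c / ?m * (\<Sum>j\<in>UNIV. y $ Inr j))"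
      by simp
    also have "\<dots> = rate * c * (?m * (\<Sum>i\<in>UNIV. y $ Inl i) - ?n * (\<Sum>j\<in>UNIV. y $ Inr j))"
      by (simp add: rate_def field_simps)
    also have "\<dots> = y \<bullet> ((rate * c) *\<^sub>R x0)"
      by (simp add: inner_vec_def sum_UNIV_sum_type sum_distrib_left sum_negf algebra_simps)
    finally show ?thesis by (simp add: lap_form)
  qed
  then show ?thesis using vector_eq_ldot by blast
qed

text \<open>Projection onto \<open>layer_vector\<close>. The cross terms of the form vanish once
  \<open>layer_vector\<close> is an eigenvector; \<open>W\<close> and \<open>r\<close> are
  quantified last, so the same \<open>a\<close> and \<open>y\<close> serve every matrix.\<close>

lemma orthogonal_decomposition:
  assumes "x \<bullet> 1 = 0"
  obtains a y where "x = a *\<^sub>R x0 + y" "y \<bullet> 1 = 0" "y \<bullet> x0 = 0"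
    "x \<bullet> x = a\<^sup>2 * (x0 \<bullet> x0) + y \<bullet> y"
    "\<And>W r. lap W *v x0 = r *\<^sub>R x0 \<Longrightarrow> form W x x = r * (a\<^sup>2 * (x0 \<bullet> x0)) + form W y y"
proof -
  define a where "a = (x \<bullet> x0) / (x0 \<bullet> x0)"
  define y where "y = x - a *\<^sub>R x0"
  have x: "x = a *\<^sub>R x0 + y" by (simp add: y_def)
  have y1: "y \<bullet> 1 = 0" using assms by (simp add: y_def inner_diff_left layer_vector_inner_one)
  have y0: "y \<bullet> x0 = 0" using layer_vector_nonzero by (simp add: y_def inner_diff_left a_def)
  have "form W x x = r * (a\<^sup>2 * (x0 \<bullet> x0)) + form W y y" if "lap W *v x0 = r *\<^sub>R x0" for W r
  proof -
    have "x0 \<bullet> (lap W *v y) = 0"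
      using y0 that by (simp add: symmetric_dot_commute[OF transpose_network_laplacian] inner_commute)
    then show ?thesis
      unfolding lap_form[symmetric] x
      by (simp add: matrix_vector_right_distrib matrix_vector_mult_scaleR that inner_add_left
          inner_add_right y0 power2_eq_square)
  qed
  moreover have "x \<bullet> x = a\<^sup>2 * (x0 \<bullet> x0) + y \<bullet> y"
    using y0 by (simp add: x inner_add_left inner_add_right inner_commute power2_eq_square)
  ultimately show thesis using that x y1 y0 by blast
qed

section \<open>From a spectral gap to larger budgets\<close>

lemma unit_regular_weights:
  obtains R where "R \<in> weights E3 1" "regular_weights R"
proof -
  obtain b W where W: "b > 0" "W \<in> weights E3 b" "regular_weights W"
    using feasible by (auto simp: regularity_feasible_def)
  let ?R = "(1 / b) *\<^sub>R W"
  have t: "transpose ?R = (1 / b) *\<^sub>R transpose W" by (simp add: transpose_def vec_eq_iff)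
  have "?R \<in> weights E3 1"
    using W(1,2) by (simp add: weights_def inner_one_matrix_one flip: sum_divide_distrib)
  moreover have "regular_weights ?R"
    using W(3) unfolding regular_weights_def t by (simp add: scaleR_matrix_vector_assoc[symmetric] span_scale)
  ultimately show thesis using that by blast
qed

text \<open>The matrix \<open>W\<close> may differ from \<open>W0\<close>: the latter only certifies
  that the maximal second eigenvalue is at least \<open>rate * c\<close>, while \<open>W\<close> is
  a maximizer whose second and third eigenvalues differ. \<open>eigval_gap\<close> applies to it,
  with the third eigenvalue as \<open>g\<close>.\<close>

lemma spectral_gap_below_coalescence:
  assumes c: "0 \<le> c" and W0: "attains_rate c W0" and "\<not> eigenvalues_coalesce E1 E2 E3 c"
  obtains W g where "W \<in> weights E3 c" "lap W *v x0 = (rate * c) *\<^sub>R x0" "rate * c < g"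
    "\<And>y. y \<bullet> 1 = 0 \<Longrightarrow> y \<bullet> x0 = 0 \<Longrightarrow> g * (y \<bullet> y) \<le> form W y y"
proof (cases "3 \<le> CARD('a) + CARD('b)")
  case True
  then obtain W where W: "W \<in> max_connectivity_weights E1 E2 E3 c"
    and ne: "eigval 2 (lap W) \<noteq> eigval 3 (lap W)"
    using assms(3) by (auto simp: eigenvalues_coalesce_def)
  have Ww: "W \<in> weights E3 c" using W by (simp add: max_connectivity_weights_def)
  then have "0 \<le> x \<bullet> (lap W *v x)" for x
    unfolding lap_form by (intro network_form_nonneg) (simp add: weights_def)
  moreover have "rate * c \<le> eigval 2 (lap W)"
  proof -
    have "rate * c \<le> eigval 2 (lap W0)"
      using W0 True by (intro second_eigval_ge[where y = 1] transpose_network_laplacian)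
        (auto simp: lap_form attains_rate_def)
    also have "\<dots> \<le> eigval 2 (lap W)"
      using W W0 by (simp add: max_connectivity_weights_def attains_rate_def)
    finally show ?thesis .
  qed
  moreover have "x0 \<bullet> (lap W *v x0) = rate * c * (x0 \<bullet> x0)"
    by (simp add: lap_form form_layer_vector[OF Ww])
  moreover have "0 \<le> rate * c" using rate_pos c by simp
  moreover have "3 \<le> CARD('a + 'b)" using True by simp
  moreover have "(1 :: real ^ ('a + 'b)) \<noteq> 0" by simp
  ultimately have "lap W *v x0 = (rate * c) *\<^sub>R x0" "rate * c < eigval 3 (lap W)"
    "\<And>y. y \<bullet> 1 = 0 \<Longrightarrow> y \<bullet> x0 = 0 \<Longrightarrow> eigval 3 (lap W) * (y \<bullet> y) \<le> y \<bullet> (lap W *v y)"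
    using eigval_gap[OF transpose_network_laplacian _ _ lap_one _ layer_vector_nonzero
        layer_vector_inner_one _ _ _ ne] by blast+
  with Ww show thesis by (intro that) (auto simp: lap_form)
next
  case False
  \<comment> \<open>There is no third eigenvalue here. The all-ones vector and
    \<open>layer_vector\<close> span the space, so the gap bound concerns only \<open>y = 0\<close>
    and any \<open>g\<close> above \<open>rate * c\<close> will do.\<close>
  have card: "CARD('a) = 1" "CARD('b) = 1"
    using False zero_less_card_finite[where 'a = 'a] zero_less_card_finite[where 'a = 'b] by linarith+
  then obtain i j where ij: "(UNIV :: 'a set) = {i}" "(UNIV :: 'b set) = {j}"
    by (metis card_1_singletonE)
  have W: "W0 \<in> weights E3 c" using W0 by (simp add: attains_rate_def)
  have "lap W0 *v x0 = (rate * c) *\<^sub>R x0"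
  proof (rule rayleigh_minimizer_eigenvector[OF transpose_network_laplacian, where S = "{x. x \<bullet> 1 = 0}"])
    show "subspace {x :: real ^ ('a + 'b). x \<bullet> 1 = 0}" by (auto simp: subspace_def inner_add_left)
  qed (use W0 in \<open>auto simp: lap_form form_layer_vector[OF W] layer_vector_inner_one attains_rate_def
      lap_one simp flip: symmetric_dot_commute[OF transpose_network_laplacian]\<close>)
  moreover have "y = 0" if "y \<bullet> 1 = 0" "y \<bullet> x0 = 0" for y
  proof -
    have "y $ Inl i = 0 \<and> y $ Inr j = 0"
      using that by (simp add: inner_vec_def sum_UNIV_sum_type ij card)
    then show "y = 0"
      unfolding vec_eq_iff using ij by (metis UNIV_I singletonD sum.exhaust zero_index)
  qed
  ultimately show thesis
    using that[of W0 "rate * c + 1"] W by (force simp: network_form_def link_sum_def)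
qed

text \<open>Adding \<open>e\<close> times a regular matrix of unit budget raises the eigenvalue of
  \<open>layer_vector\<close> to exactly \<open>rate * (c + e)\<close>, while on the remaining
  complement the form can only grow and keeps the bound \<open>g\<close>.\<close>

lemma attains_rate_extend:
  assumes W: "W \<in> weights E3 c" "lap W *v x0 = (rate * c) *\<^sub>R x0"
    and gap: "\<And>y. y \<bullet> 1 = 0 \<Longrightarrow> y \<bullet> x0 = 0 \<Longrightarrow> g * (y \<bullet> y) \<le> form W y y"
    and e: "0 \<le> e" "rate * (c + e) \<le> g"
  obtains W' where "attains_rate (c + e) W'"
proof -
  obtain R where R: "R \<in> weights E3 1" "regular_weights R" using unit_regular_weights .
  define W' where "W' = W + e *\<^sub>R R"
  \<comment> \<open>The form is affine in the weights; \<open>form 0\<close> is the share of the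
    layer links, so the difference isolates the interlayer part of \<open>R\<close>.\<close>
  have add: "form W' y x = form W y x + e * (form R y x - form 0 y x)" for y x
    using network_form_add_weights[of E1 E2 0 R y x]
    by (simp add: W'_def network_form_add_weights sum_distrib_left mult.assoc)
  have "W' \<in> weights E3 (c + e)"
    using W(1) R(1) e(1)
    by (simp add: W'_def weights_def inner_one_matrix_one sum.distrib flip: sum_distrib_left)
  moreover have "lap W' *v x0 = (rate * (c + e)) *\<^sub>R x0"
  proof -
    have "form 0 y x0 = 0" for y
      by (simp add: network_form_layer_vector)
    then have "y \<bullet> (lap W' *v x0) = y \<bullet> ((rate * (c + e)) *\<^sub>R x0)" for y
      unfolding lap_form add
      by (simp flip: lap_form add: W(2) regular_eigenvector[OF R] algebra_simps)
    then show ?thesis using vector_eq_ldot by blast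
  qed
  note eig = this
  moreover have "rate * (c + e) * (x \<bullet> x) \<le> form W' x x" if x: "x \<bullet> 1 = 0" for x
  proof -
    obtain a y where y: "y \<bullet> 1 = 0" "y \<bullet> x0 = 0" and xx: "x \<bullet> x = a\<^sup>2 * (x0 \<bullet> x0) + y \<bullet> y"
      and f: "form W' x x = rate * (c + e) * (a\<^sup>2 * (x0 \<bullet> x0)) + form W' y y"
      using orthogonal_decomposition[OF x] eig by metis
    have "rate * (c + e) * (y \<bullet> y) \<le> g * (y \<bullet> y)" using e(2) by (rule mult_right_mono) simp
    also have "\<dots> \<le> form W y y" using gap y .
    also have "\<dots> \<le> form W' y y"
      using e(1) R(1) unfolding W'_def network_form_add_weights
      by (auto simp: weights_def intro!: sum_nonneg)
    finally show ?thesis by (simp add: xx f distrib_left)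
  qed
  ultimately show thesis using that unfolding attains_rate_def by blast
qed

lemma attains_rate_zero: "attains_rate 0 0"
  by (auto simp: attains_rate_def weights_def inner_one_matrix_one intro: network_form_nonneg)

text \<open>Continuation in the budget: a matrix of largest budget can be extended unless it already
  exhausts \<open>c\<close>. Non-coalescence is invoked only at budgets strictly below
  \<open>c\<close>, so \<open>c\<close> equal to the threshold is included.\<close>

lemma attains_rate_upto_threshold:
  assumes c: "0 \<le> c" "ereal c \<le> threshold_budget E1 E2 E3"
  obtains W where "attains_rate c W"
proof -
  let ?budget = "\<lambda>W :: real ^ 'b ^ 'a. \<Sum>i\<in>UNIV. \<Sum>j\<in>UNIV. W $ i $ j"
  define T where "T = {W. attains_rate (?budget W) W \<and> ?budget W \<le> c}"
  have T: "T = {W. (\<forall>i j. 0 \<le> W $ i $ j) \<and> (\<forall>i j. (i, j) \<notin> E3 \<longrightarrow> W $ i $ j = 0) \<and>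
      (\<forall>x. x \<bullet> 1 = 0 \<longrightarrow> rate * ?budget W * (x \<bullet> x) \<le> form W x x) \<and> ?budget W \<le> c}"
    by (auto simp: T_def attains_rate_def weights_def inner_one_matrix_one)
  have "closed T"
    unfolding T
    by (intro closed_Collect_conj closed_Collect_all closed_Collect_imp open_Collect_const
        closed_Collect_le closed_Collect_eq continuous_intros)
  \<comment> \<open>The entries are nonnegative, so the budget is the entrywise l1 norm.\<close>
  moreover have "norm W \<le> c" if "W \<in> T" for W
  proof -
    have "norm W \<le> (\<Sum>i\<in>UNIV. norm (W $ i))"
      unfolding norm_vec_def by (rule L2_set_le_sum) simp
    also have "\<dots> \<le> (\<Sum>i\<in>UNIV. \<Sum>j\<in>UNIV. \<bar>W $ i $ j\<bar>)"
      by (intro sum_mono norm_le_l1_cart)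
    also have "\<dots> = ?budget W" using that by (simp add: T)
    finally show ?thesis using that by (simp add: T)
  qed
  then have "bounded T" by (auto simp: bounded_iff)
  ultimately have "compact T" by (simp add: compact_eq_bounded_closed)
  moreover have "0 \<in> T" using attains_rate_zero c by (simp add: T_def)
  then have "T \<noteq> {}" by blast
  moreover have "continuous_on T ?budget" by (intro continuous_intros)
  ultimately have "\<exists>W\<in>T. \<forall>V\<in>T. ?budget V \<le> ?budget W" by (rule continuous_attains_sup)
  then obtain W where W: "W \<in> T" and max: "\<And>V. V \<in> T \<Longrightarrow> ?budget V \<le> ?budget W" by blast
  define s where "s = ?budget W"
  have s: "attains_rate s W" "s \<le> c" "0 \<le> s"
    using W by (auto simp: s_def T_def attains_rate_def weights_def intro!: sum_nonneg)
  have "s = c"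
  proof (rule ccontr)
    assume "s \<noteq> c"
    then have "s < c" using s by simp
    have "\<not> eigenvalues_coalesce E1 E2 E3 s"
    proof
      assume "eigenvalues_coalesce E1 E2 E3 s"
      then have "threshold_budget E1 E2 E3 \<le> ereal s"
        unfolding threshold_budget_def using s(3) by (intro INF_lower) simp
      then show False using c(2) \<open>s < c\<close> by (metis ereal_less_eq(3) not_le order_trans)
    qed
    from spectral_gap_below_coalescence[OF s(3,1) this]
    obtain V g where V: "V \<in> weights E3 s" "lap V *v x0 = (rate * s) *\<^sub>R x0" "rate * s < g"
      "\<And>y. y \<bullet> 1 = 0 \<Longrightarrow> y \<bullet> x0 = 0 \<Longrightarrow> g * (y \<bullet> y) \<le> form V y y" by metis
    \<comment> \<open>The increment respects both the remaining budget and the room up to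
      \<open>g\<close>.\<close>
    define e where "e = min (c - s) ((g - rate * s) / rate)"
    have e: "0 < e" "s + e \<le> c" using \<open>s < c\<close> V(3) rate_pos by (auto simp: e_def)
    have "e \<le> (g - rate * s) / rate" by (simp add: e_def)
    then have "rate * (s + e) \<le> g" using rate_pos by (simp add: field_simps)
    with attains_rate_extend[OF V(1,2,4)] e obtain V' where V': "attains_rate (s + e) V'"
      by (metis less_imp_le)
    then have "?budget V' = s + e" by (simp add: attains_rate_def weights_def inner_one_matrix_one)
    with V' e have "V' \<in> T" by (simp add: T_def)
    from max[OF this] show False using \<open>?budget V' = s + e\<close> e by (simp add: s_def)
  qed
  with s that show thesis by blast
qed

subsection \<open>Duality for the embedding problem\<close>

text \<open>The coordinates with a fixed index \<open>k\<close> form one vector on the nodes;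
  summing over \<open>k\<close> turns squared coordinate differences into squared distances. The
  left side is the trace of Laplacian times Gram matrix.\<close>

lemma embedding_coordinates_sum_form:
  "(\<Sum>k\<in>UNIV. form W (\<chi> p. u p $ k) (\<chi> p. u p $ k)) =
     link_sum (layer_links E1 E2) (\<lambda>i j. (norm (u i - u j))\<^sup>2) +
     (\<Sum>i\<in>UNIV. \<Sum>j\<in>UNIV. W $ i $ j * (norm (u (Inl i) - u (Inr j)))\<^sup>2)"
  for u :: "'a + 'b \<Rightarrow> real ^ 'k::finite"
proof -
  have "(\<Sum>k\<in>UNIV. \<Sum>i\<in>UNIV. \<Sum>j\<in>UNIV. W $ i $ j * f i j k) =
      (\<Sum>i\<in>UNIV. \<Sum>j\<in>UNIV. W $ i $ j * (\<Sum>k\<in>UNIV. f i j k))" for f :: "'a \<Rightarrow> 'b \<Rightarrow> 'k \<Rightarrow> real"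
    unfolding sum_distrib_left by (subst sum.swap) (intro sum.cong refl sum.swap)
  then show ?thesis
    by (simp add: network_form_def sum.distrib norm_power2_coordinates link_sum_sum)
qed

text \<open>The weights act as Lagrange multipliers: the distance constraints are multiplied by
  \<open>W $ i $ j\<close> and added, and the weights total \<open>c\<close>.\<close>

lemma embedding_weak_duality:
  assumes u: "embedding_feasible E3 \<xi> u" and W: "W \<in> weights E3 c"
  shows "embedding_objective E1 E2 c \<xi> u \<le> - (\<Sum>k\<in>UNIV. form W (\<chi> p. u p $ k) (\<chi> p. u p $ k))"
proof -
  have "W $ i $ j * (norm (u (Inl i) - u (Inr j)))\<^sup>2 \<le> W $ i $ j * (- \<xi>)" for i j
  proof (cases "(i, j) \<in> E3")
    case True
    then have "(norm (u (Inl i) - u (Inr j)))\<^sup>2 \<le> - \<xi>" using u by (auto simp: embedding_feasible_def)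
    then show ?thesis using W by (intro mult_left_mono) (auto simp: weights_def)
  qed (use W in \<open>simp add: weights_def\<close>)
  then have "(\<Sum>i\<in>UNIV. \<Sum>j\<in>UNIV. W $ i $ j * (norm (u (Inl i) - u (Inr j)))\<^sup>2)
      \<le> (\<Sum>i\<in>UNIV. \<Sum>j\<in>UNIV. W $ i $ j * (- \<xi>))"
    by (intro sum_mono)
  also have "\<dots> = - (c * \<xi>)"
    using W by (simp add: weights_def inner_one_matrix_one sum_negf flip: sum_distrib_right)
  finally show ?thesis
    by (simp add: embedding_objective_def embedding_coordinates_sum_form)
qed

lemma embedding_coordinates:
  assumes "embedding_feasible E3 \<xi> u"
  shows "(\<chi> p. u p $ k) \<bullet> 1 = 0"
    and "(\<Sum>k\<in>UNIV. (\<chi> p. u p $ k) \<bullet> (\<chi> p. u p $ k)) = 1"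
proof -
  have "(\<Sum>p\<in>UNIV. u p) $ k = 0" using assms by (simp add: embedding_feasible_def)
  then show "(\<chi> p. u p $ k) \<bullet> 1 = 0" by (simp add: inner_vec_def)
  have "(\<Sum>p\<in>UNIV. \<Sum>k\<in>UNIV. u p $ k * u p $ k) = 1"
    using assms by (simp add: embedding_feasible_def norm_power2_coordinates)
  then show "(\<Sum>k\<in>UNIV. (\<chi> p. u p $ k) \<bullet> (\<chi> p. u p $ k)) = 1"
    by (subst (asm) sum.swap) (simp add: inner_vec_def)
qed

text \<open>Centering makes each coordinate vector orthogonal to the all-ones vector, where
  \<open>attains_rate\<close> bounds the form, and normalization makes their squared norms add up to
  1.\<close>

lemma embedding_objective_le:
  assumes u: "embedding_feasible E3 \<xi> u" and W: "attains_rate c W"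
  shows "embedding_objective E1 E2 c \<xi> u \<le> - (rate * c)"
proof -
  let ?X = "\<lambda>k. \<chi> p. u p $ k"
  have "rate * c = (\<Sum>k\<in>UNIV. rate * c * (?X k \<bullet> ?X k))"
    by (simp add: embedding_coordinates(2)[OF u] flip: sum_distrib_left)
  also have "\<dots> \<le> (\<Sum>k\<in>UNIV. form W (?X k) (?X k))"
    using W embedding_coordinates(1)[OF u] by (intro sum_mono) (simp add: attains_rate_def)
  also have "\<dots> \<le> - embedding_objective E1 E2 c \<xi> u"
    using embedding_weak_duality[OF u] W by (simp add: attains_rate_def le_minus_iff)
  finally show ?thesis by simp
qed

lemma two_point_embedding_norm_sum:
  "(\<Sum>i\<in>UNIV. (norm (two_point_embedding h i :: real ^ ('a + 'b)))\<^sup>2) = (x0 \<bullet> x0) * (norm h)\<^sup>2"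
  by (simp add: two_point_embedding_layer_vector power_mult_distrib inner_vec_def
      flip: sum_distrib_right power2_eq_square)

lemma two_point_embedding_value:
  assumes h: "(\<Sum>i\<in>UNIV. (norm (two_point_embedding h i :: real ^ ('a + 'b)))\<^sup>2) = 1"
  obtains \<xi> where "embedding_feasible E3 \<xi> (two_point_embedding h)"
    "embedding_objective E1 E2 c \<xi> (two_point_embedding h) = - (rate * c)"
proof -
  let ?s = "real CARD('a) + real CARD('b)"
  \<comment> \<open>All interlayer distances are equal, and this value makes every distance
    constraint tight.\<close>
  define \<xi> where "\<xi> = - (?s\<^sup>2 * (norm h)\<^sup>2)"
  have diff: "two_point_embedding h (Inl i :: 'a + 'b) - two_point_embedding h (Inr j) = ?s *\<^sub>R h" for i j
    by (simp add: two_point_embedding_def algebra_simps)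
  have "(\<Sum>i\<in>UNIV. two_point_embedding h (i :: 'a + 'b)) = 0"
    by (simp add: sum_UNIV_sum_type two_point_embedding_def sum_constant_scaleR del: sum_constant)
  then have "embedding_feasible E3 \<xi> (two_point_embedding h)"
    using h by (simp add: embedding_feasible_def diff \<xi>_def power_mult_distrib)
  \<comment> \<open>The normalization n m (n + m) |h|^2 = 1 turns the squared interlayer distance
    into 1/n + 1/m.\<close>
  moreover have "?s\<^sup>2 * (norm h)\<^sup>2 = rate"
  proof -
    have "?s\<^sup>2 * (norm h)\<^sup>2 = rate * ((x0 \<bullet> x0) * (norm h)\<^sup>2)"
      unfolding layer_vector_inner_self by (simp add: power2_eq_square rate_mult[symmetric] mult_ac)
    then show ?thesis using h unfolding two_point_embedding_norm_sum by (simp only: mult_1_right)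
  qed
  then have "embedding_objective E1 E2 c \<xi> (two_point_embedding h) = - (rate * c)"
    unfolding embedding_objective_def link_sum_layer_links
    by (simp add: link_sum_def two_point_embedding_def \<xi>_def)
  ultimately show thesis by (rule that)
qed

lemma two_point_embedding_optimal:
  assumes "attains_rate c W"
    and "(\<Sum>i\<in>UNIV. (norm (two_point_embedding h i :: real ^ ('a + 'b)))\<^sup>2) = 1"
  shows "\<exists>\<xi>. embedding_optimal E1 E2 E3 c \<xi> (two_point_embedding h)"
  using two_point_embedding_value[OF assms(2)] embedding_objective_le[OF _ assms(1)]
  unfolding embedding_optimal_def by metis

lemma normalized_two_point_embedding:
  obtains h where "(\<Sum>i\<in>UNIV. (norm (two_point_embedding h i :: real ^ ('a + 'b)))\<^sup>2) = 1"
proof -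
  \<comment> \<open>\<open>axis undefined 1\<close> is just some unit vector; the direction is
    free.\<close>
  let ?h = "(1 / norm x0) *\<^sub>R (axis undefined 1 :: real ^ ('a + 'b))"
  have "(x0 \<bullet> x0) * (norm ?h)\<^sup>2 = 1"
    using layer_vector_nonzero by (simp add: power2_norm_eq_inner[symmetric] power_divide norm_axis_1)
  then show thesis using that[of ?h] unfolding two_point_embedding_norm_sum by blast
qed

text \<open>The part of a coordinate vector orthogonal to \<open>layer_vector\<close> costs at least
  \<open>g - rate * c\<close> extra per unit of squared norm. An optimal embedding does no worse
  than a two-point one, so these parts vanish.\<close>

lemma embedding_optimal_two_point:
  assumes c: "0 \<le> c" "attains_rate c W0" "\<not> eigenvalues_coalesce E1 E2 E3 c"
    and opt: "embedding_optimal E1 E2 E3 c \<xi> u"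
  obtains h where "u = two_point_embedding h"
proof -
  let ?X = "\<lambda>k. \<chi> p. u p $ k"
  obtain W g where W: "W \<in> weights E3 c" "lap W *v x0 = (rate * c) *\<^sub>R x0" and g: "rate * c < g"
    and gap: "\<And>y. y \<bullet> 1 = 0 \<Longrightarrow> y \<bullet> x0 = 0 \<Longrightarrow> g * (y \<bullet> y) \<le> form W y y"
    using spectral_gap_below_coalescence[OF c] by metis
  have u: "embedding_feasible E3 \<xi> u" using opt by (simp add: embedding_optimal_def)
  have "\<exists>a y. ?X k = a *\<^sub>R x0 + y \<and> rate * c * (?X k \<bullet> ?X k) + (g - rate * c) * (y \<bullet> y) \<le> form W (?X k) (?X k)" for k
  proof -
    obtain a y where y: "?X k = a *\<^sub>R x0 + y" "y \<bullet> 1 = 0" "y \<bullet> x0 = 0"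
      and xx: "?X k \<bullet> ?X k = a\<^sup>2 * (x0 \<bullet> x0) + y \<bullet> y"
      and f: "form W (?X k) (?X k) = rate * c * (a\<^sup>2 * (x0 \<bullet> x0)) + form W y y"
      using orthogonal_decomposition[OF embedding_coordinates(1)[OF u]] W(2) by metis
    show ?thesis
      using gap[OF y(2,3)] y(1) unfolding xx f
      by (intro exI[of _ a] exI[of _ y]) (simp add: algebra_simps)
  qed
  then obtain a y where X: "\<And>k. ?X k = a k *\<^sub>R x0 + y k"
    and le: "\<And>k. rate * c * (?X k \<bullet> ?X k) + (g - rate * c) * (y k \<bullet> y k) \<le> form W (?X k) (?X k)"
    by metis
  have "rate * c + (g - rate * c) * (\<Sum>k\<in>UNIV. y k \<bullet> y k)
      = (\<Sum>k\<in>UNIV. rate * c * (?X k \<bullet> ?X k) + (g - rate * c) * (y k \<bullet> y k))"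
    by (simp add: sum.distrib embedding_coordinates(2)[OF u] flip: sum_distrib_left)
  also have "\<dots> \<le> (\<Sum>k\<in>UNIV. form W (?X k) (?X k))" by (intro sum_mono le)
  also have "\<dots> \<le> - embedding_objective E1 E2 c \<xi> u"
    using embedding_weak_duality[OF u W(1)] by simp
  also have "\<dots> \<le> rate * c"
  proof -
    obtain h where "(\<Sum>i\<in>UNIV. (norm (two_point_embedding h i :: real ^ ('a + 'b)))\<^sup>2) = 1"
      using normalized_two_point_embedding .
    from two_point_embedding_value[OF this, of c] opt show ?thesis
      unfolding embedding_optimal_def by (metis minus_le_iff)
  qed
  finally have "(\<Sum>k\<in>UNIV. y k \<bullet> y k) \<le> 0" using g by (simp add: mult_le_0_iff)
  then have "(\<Sum>k\<in>UNIV. y k \<bullet> y k) = 0" by (intro antisym sum_nonneg) auto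
  then have "y k = 0" for k by (subst (asm) sum_nonneg_eq_0_iff) auto
  then have "u p $ k = x0 $ p * a k" for p k
    using arg_cong[OF X[of k], of "\<lambda>v. v $ p"] by simp
  \<comment> \<open>The coefficients of \<open>layer_vector\<close> in the separate coordinates are
    the coordinates of \<open>h\<close>.\<close>
  then have "u = two_point_embedding (\<chi> k. a k)"
    by (simp add: fun_eq_iff vec_eq_iff two_point_embedding_layer_vector)
  then show thesis by (rule that)
qed

end

text \<open>Optimality needs only a dual certificate of value \<open>rate * c\<close>, which exists
  up to and including the threshold. The converse rests on a strict eigenvalue gap and is asserted
  strictly below the threshold, where coalescence is excluded.\<close>

theorem proposition4p2:
  fixes E1 :: "'a::finite set set" and E2 :: "'b::finite set set"
    and E3 :: "('a \<times> 'b) set" and c :: real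
  assumes "simple_graph E1" and "connected_graph E1"
    and "simple_graph E2" and "connected_graph E2"
    and "regularity_feasible E3"
    and "0 \<le> c" and "ereal c \<le> threshold_budget E1 E2 E3"
  shows "(\<exists>h. dim (span {h}) = 1 \<and>
            (\<exists>\<xi>. embedding_optimal E1 E2 E3 c \<xi> (two_point_embedding h))) \<and>
         (\<forall>h. (\<Sum>i\<in>UNIV. (norm (two_point_embedding h i :: real ^ ('a + 'b)))\<^sup>2) = 1 \<longrightarrow>
            (\<exists>\<xi>. embedding_optimal E1 E2 E3 c \<xi> (two_point_embedding h))) \<and>
         (ereal c < threshold_budget E1 E2 E3 \<longrightarrow>
            (\<forall>\<xi> u. embedding_optimal E1 E2 E3 c \<xi> u \<longrightarrow>
               (\<exists>h. dim (span {h}) = 1 \<and> u = two_point_embedding h)))"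
proof -
  interpret two_layer_network E1 E2 E3 using assms by unfold_locales
  obtain W where W: "attains_rate c W" using attains_rate_upto_threshold assms(6,7) .
  have dim: "dim (span {h}) = 1"
    if "(\<Sum>i\<in>UNIV. (norm (two_point_embedding h i :: real ^ ('a + 'b)))\<^sup>2) = 1" for h
  proof -
    have "h \<noteq> 0" using that by (auto simp: two_point_embedding_norm_sum)
    then show ?thesis by (simp add: dim_insert)
  qed
  note optimal = two_point_embedding_optimal[OF W]
  obtain h0 where h0: "(\<Sum>i\<in>UNIV. (norm (two_point_embedding h0 i :: real ^ ('a + 'b)))\<^sup>2) = 1"
    using normalized_two_point_embedding .
  have "\<exists>h. dim (span {h}) = 1 \<and> u = two_point_embedding h"
    if lt: "ereal c < threshold_budget E1 E2 E3" and opt: "embedding_optimal E1 E2 E3 c \<xi> u" for \<xi> u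
  proof -
    have "\<not> eigenvalues_coalesce E1 E2 E3 c"
    proof
      assume "eigenvalues_coalesce E1 E2 E3 c"
      then have "threshold_budget E1 E2 E3 \<le> ereal c"
        unfolding threshold_budget_def using assms(6) by (intro INF_lower) simp
      with lt show False by simp
    qed
    then obtain h where "u = two_point_embedding h"
      using embedding_optimal_two_point[OF assms(6) W _ opt] by metis
    moreover have "(\<Sum>i\<in>UNIV. (norm (u i))\<^sup>2) = 1"
      using opt by (simp add: embedding_optimal_def embedding_feasible_def)
    ultimately show ?thesis using dim by blast
  qed
  with optimal h0 dim show ?thesis by blast
qed

end
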